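(* Let $G$ be a finite group of order $n$, $A=(a_0,\dots,a_{n-1})$ an ordering of its elements, and $q_b=a_{b-1}a_b^{-1}$ for $b=1,\dots,n-1$. Let $\mu$ be a stable matching of the regular anti-phase template $P(G,A)$ with index function $d$ and maximal index $b=\max_{g\in G} d_g$. If $b=0$, or if $b\ge 1$ and $\langle q_b\rangle=G$, then $\mu=\mu_b$. Consequently, if $\langle q_b\rangle=G$ for every $b=1,\dots,n-1$, then $$\operatorname{Stab}(P(G,A))=\{\mu_0,\dots,\mu_{n-1}\},$$ so $|\operatorname{Stab}(P(G,A))|=n$ and the stable lattice $L(P(G,A))$ is an $n$-element chain.
   Context: A strict complete profile consists of equally many men and women, each with a strict total order over all participants of the opposite side. A matching is a bijection $\mu$ from men to women. A pair $(m,w)$ blocks $\mu$ if $m$ prefers $w$ to $\mu(m)$ and $w$ prefers $m$ to $\mu^{-1}(w)$; $\mu$ is stable if no pair blocks it. $\operatorname{Stab}(S)$ is the set of stable matchings of a profile $S$; the stable lattice $L(S)$ is $\operatorname{Stab}(S)$ with the men-dominance order: $\mu\succeq_M\nu$ if every man weakly prefers his partner in $\mu$ to his partner in $\nu$. An ordering of $G$ is a tuple listing each element exactly once. The regular anti-phase template $P(G,A)$ is the profile with men $m_g$ and women $w_g$ indexed by $g\in G$ and lists $$m_g:\ w_{ga_0}\succ w_{ga_1}\succ\cdots\succ w_{ga_{n-1}},\qquad w_h:\ m_{ha_{n-1}^{-1}}\succ m_{ha_{n-2}^{-1}}\succ\cdots\succ m_{ha_0^{-1}}.$$ For $t=0,\dots,n-1$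 the canonical matching $\mu_t$ is $\mu_t(m_g)=w_{ga_t}$ for all $g\in G$. The index function of a matching $\mu$ of $P(G,A)$ is the function $d:G\to\{0,\dots,n-1\}$ determined by $\mu(m_g)=w_{ga_{d_g}}$. *)

theory Defs
  imports "HOL-Algebra.Lattice" "HOL-Algebra.Generated_Groups"
begin

section \<open>Stable matchings\<close>

text \<open>
  A preference is a strict order given as a set of pairs: \<open>(x, y) \<in> r\<close> means that \<open>x\<close> is
  strictly preferred to \<open>y\<close>.
\<close>

record ('m, 'w) profile =
  men :: "'m set"
  women :: "'w set"
  man_pref :: "'m \<Rightarrow> 'w rel"
  woman_pref :: "'w \<Rightarrow> 'm rel"

definition strict_complete_profile :: "('m, 'w) profile \<Rightarrow> bool" where
  "strict_complete_profile S \<longleftrightarrow>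
     finite (men S) \<and> finite (women S) \<and> card (men S) = card (women S) \<and>
     (\<forall>m\<in>men S. man_pref S m \<subseteq> women S \<times> women S \<and>
        strict_linear_order_on (women S) (man_pref S m)) \<and>
     (\<forall>w\<in>women S. woman_pref S w \<subseteq> men S \<times> men S \<and>
        strict_linear_order_on (men S) (woman_pref S w))"

text \<open>
  Matchings are \<open>undefined\<close> outside the set of men, so that distinct functions are distinct
  matchings.
\<close>

definition matching :: "('m, 'w) profile \<Rightarrow> ('m \<Rightarrow> 'w) \<Rightarrow> bool" where
  "matching S \<mu> \<longleftrightarrow> \<mu> \<in> extensional (men S) \<and> bij_betw \<mu> (men S) (women S)"

definition blocks :: "('m, 'w) profile \<Rightarrow> ('m \<Rightarrow> 'w) \<Rightarrow> 'm \<Rightarrow> 'w \<Rightarrow> bool" where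
  "blocks S \<mu> m w \<longleftrightarrow>
     m \<in> men S \<and> w \<in> women S \<and>
     (w, \<mu> m) \<in> man_pref S m \<and> (m, inv_into (men S) \<mu> w) \<in> woman_pref S w"

definition Stab :: "('m, 'w) profile \<Rightarrow> ('m \<Rightarrow> 'w) set" where
  "Stab S = {\<mu>. matching S \<mu> \<and> (\<nexists>m w. blocks S \<mu> m w)}"

definition men_dominates :: "('m, 'w) profile \<Rightarrow> ('m \<Rightarrow> 'w) \<Rightarrow> ('m \<Rightarrow> 'w) \<Rightarrow> bool" where
  "men_dominates S \<mu> \<nu> \<longleftrightarrow>
     (\<forall>m\<in>men S. \<mu> m = \<nu> m \<or> (\<mu> m, \<nu> m) \<in> man_pref S m)"

text \<open>In the stable lattice, the men-dominating matching is the larger one.\<close>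

definition stable_lattice :: "('m, 'w) profile \<Rightarrow> ('m \<Rightarrow> 'w) gorder" where
  "stable_lattice S =
     \<lparr>carrier = Stab S, eq = (=), le = (\<lambda>\<nu> \<mu>. men_dominates S \<mu> \<nu>)\<rparr>"

section \<open>The regular anti-phase template\<close>

definition list_pref :: "'a list \<Rightarrow> 'a rel" where
  "list_pref xs = {(xs ! i, xs ! j) | i j. i < j \<and> j < length xs}"

definition ordering_of :: "('a, 'b) monoid_scheme \<Rightarrow> 'a list \<Rightarrow> bool" where
  "ordering_of G A \<longleftrightarrow> distinct A \<and> set A = carrier G"

text \<open>
  The man \<open>m\<^sub>g\<close> and the woman \<open>w\<^sub>g\<close> are both represented by their index \<open>g\<close>; the two
  sides are kept apart by the profile record.
\<close>

definition anti_phase_template ::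
    "('a, 'b) monoid_scheme \<Rightarrow> 'a list \<Rightarrow> ('a, 'a) profile" where
  "anti_phase_template G A =
     \<lparr>men = carrier G, women = carrier G,
      man_pref = (\<lambda>g. list_pref (map (\<lambda>a. g \<otimes>\<^bsub>G\<^esub> a) A)),
      woman_pref = (\<lambda>h. list_pref (map (\<lambda>a. h \<otimes>\<^bsub>G\<^esub> inv\<^bsub>G\<^esub> a) (rev A)))\<rparr>"

definition canonical_matching ::
    "('a, 'b) monoid_scheme \<Rightarrow> 'a list \<Rightarrow> nat \<Rightarrow> 'a \<Rightarrow> 'a" where
  "canonical_matching G A t = (\<lambda>g\<in>carrier G. g \<otimes>\<^bsub>G\<^esub> A ! t)"

definition index_function ::
    "('a, 'b) monoid_scheme \<Rightarrow> 'a list \<Rightarrow> ('a \<Rightarrow> 'a) \<Rightarrow> 'a \<Rightarrow> nat" where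
  "index_function G A \<mu> g = (THE t. t < length A \<and> \<mu> g = g \<otimes>\<^bsub>G\<^esub> A ! t)"

definition step_quotient :: "('a, 'b) monoid_scheme \<Rightarrow> 'a list \<Rightarrow> nat \<Rightarrow> 'a" where
  "step_quotient G A b = A ! (b - 1) \<otimes>\<^bsub>G\<^esub> inv\<^bsub>G\<^esub> (A ! b)"

lemma strict_linear_order_list_pref:
  assumes "distinct xs"
  shows "list_pref xs \<subseteq> set xs \<times> set xs" "strict_linear_order_on (set xs) (list_pref xs)"
proof -
  show "list_pref xs \<subseteq> set xs \<times> set xs"
    by (auto simp: list_pref_def)
  have "trans (list_pref xs)"
  proof (rule transI)
    fix x y z assume "(x, y) \<in> list_pref xs" "(y, z) \<in> list_pref xs"
    then obtain i j k l where *: "x = xs ! i" "y = xs ! j" "i < j" "j < length xs"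
      "y = xs ! k" "z = xs ! l" "k < l" "l < length xs"
      by (auto simp: list_pref_def)
    then have "j = k"
      using assms by (simp add: nth_eq_iff_index_eq)
    with * have "x = xs ! i \<and> z = xs ! l \<and> i < l \<and> l < length xs"
      by simp
    then show "(x, z) \<in> list_pref xs"
      unfolding list_pref_def by blast
  qed
  moreover have "irrefl (list_pref xs)"
    using assms by (auto simp: irrefl_def list_pref_def nth_eq_iff_index_eq)
  moreover have "total_on (set xs) (list_pref xs)"
  proof (rule total_onI)
    fix x y assume "x \<in> set xs" "y \<in> set xs" "x \<noteq> y"
    then obtain i j where "x = xs ! i" "y = xs ! j" "i < length xs" "j < length xs" "i \<noteq> j"
      by (metis in_set_conv_nth)
    then show "(x, y) \<in> list_pref xs \<or> (y, x) \<in> list_pref xs"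
      unfolding list_pref_def by (cases i j rule: linorder_cases) blast+
  qed
  ultimately show "strict_linear_order_on (set xs) (list_pref xs)"
    by (simp add: strict_linear_order_on_def)
qed

lemma strict_complete_anti_phase_template:
  assumes "group G" "ordering_of G A"
  shows "strict_complete_profile (anti_phase_template G A)"
proof -
  interpret group G by fact
  have A: "distinct A" "set A = carrier G" "finite (carrier G)"
    using assms(2) finite_set[of A] by (simp_all add: ordering_of_def)
  have inj_r: "inj_on (\<lambda>a. h \<otimes>\<^bsub>G\<^esub> inv\<^bsub>G\<^esub> a) (carrier G)" if "h \<in> carrier G" for h
    using that by (auto intro!: inj_onI) (metis inv_inv)
  have img: "(\<lambda>a. g \<otimes>\<^bsub>G\<^esub> a) ` carrier G = carrier G" "inj_on (\<lambda>a. g \<otimes>\<^bsub>G\<^esub> a) (carrier G)"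
    if "g \<in> carrier G" for g
    using that by (simp_all add: surj_const_mult inj_on_cmult)
  have img_r: "(\<lambda>a. h \<otimes>\<^bsub>G\<^esub> inv\<^bsub>G\<^esub> a) ` carrier G = carrier G" if "h \<in> carrier G" for h
    by (rule endo_inj_surj[OF A(3) _ inj_r[OF that]]) (use that in auto)
  have m: "distinct (map (\<lambda>a. g \<otimes>\<^bsub>G\<^esub> a) A)" "set (map (\<lambda>a. g \<otimes>\<^bsub>G\<^esub> a) A) = carrier G"
    if "g \<in> carrier G" for g
    using A img[OF that] by (simp_all add: distinct_map)
  have w: "distinct (map (\<lambda>a. h \<otimes>\<^bsub>G\<^esub> inv\<^bsub>G\<^esub> a) (rev A))"
    "set (map (\<lambda>a. h \<otimes>\<^bsub>G\<^esub> inv\<^bsub>G\<^esub> a) (rev A)) = carrier G"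
    if "h \<in> carrier G" for h
    using A inj_r[OF that] img_r[OF that] by (simp_all add: distinct_map)
  show ?thesis
    unfolding strict_complete_profile_def anti_phase_template_def
    using A(3) strict_linear_order_list_pref[OF m(1)] strict_linear_order_list_pref[OF w(1)]
    by (simp add: m(2) w(2) del: set_map set_rev)
qed

end

theory Submission
  imports Defs
begin

text \<open>
  Let \<open>b \<ge> 1\<close> be the maximal index of a stable matching, attained at the man \<open>g\<close>. He prefers the
  woman \<open>h = g a\<^bsub>b-1\<^esub>\<close> to his partner, so \<open>h\<close> must have a partner that she ranks above \<open>g\<close>; since
  women rank larger indices higher, that partner has index \<open>b\<close> and hence is \<open>h a\<^bsub>b\<^esub>\<inverse> = g q\<^sub>b\<close>.
  Thus the men of index \<open>b\<close> are closed under right multiplication by \<open>q\<^sub>b\<close>, and they are all of \<open>G\<close>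
  when \<open>q\<^sub>b\<close> generates \<open>G\<close>.
\<close>

section \<open>Preference lists and translation-closed sets\<close>

lemma list_pref_nth_iff:
  assumes "distinct xs" "i < length xs" "j < length xs"
  shows "(xs ! i, xs ! j) \<in> list_pref xs \<longleftrightarrow> i < j"
  using assms by (auto simp: list_pref_def nth_eq_iff_index_eq)

text \<open>Women's lists run along \<open>rev A\<close>; this allows both sides to be compared by
  positions in \<open>A\<close> itself.\<close>

lemma list_pref_rev: "list_pref (rev xs) = (list_pref xs)\<inverse>"
proof -
  have sub: "list_pref (rev ys) \<subseteq> (list_pref ys)\<inverse>" for ys :: "'a list"
  proof (rule subrelI)
    fix x y assume "(x, y) \<in> list_pref (rev ys)"
    then obtain i j where ij: "x = rev ys ! i" "y = rev ys ! j" "i < j" "j < length ys"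
      by (auto simp: list_pref_def)
    then have "x = ys ! (length ys - Suc i)" "y = ys ! (length ys - Suc j)"
      by (simp_all add: rev_nth)
    moreover have "length ys - Suc j < length ys - Suc i" "length ys - Suc i < length ys"
      using ij by auto
    ultimately show "(x, y) \<in> (list_pref ys)\<inverse>"
      unfolding list_pref_def by blast
  qed
  show ?thesis
    using sub[of xs] sub[of "rev xs"] by auto
qed

text \<open>Right multiplication by \<open>q\<close> is injective, so on the finite set
  \<open>T\<close> it is a permutation. Hence \<open>T\<close> is also closed under multiplication
  by \<open>inv q\<close>, and induction over the generated subgroup does the rest.\<close>

lemma (in group) generate_singleton_right_closed:
  assumes "finite T" "T \<subseteq> carrier G" "q \<in> carrier G"
    and closed: "\<And>g. g \<in> T \<Longrightarrow> g \<otimes> q \<in> T"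
    and "h \<in> generate G {q}" "g \<in> T"
  shows "g \<otimes> h \<in> T"
proof -
  have "inj_on (\<lambda>g. g \<otimes> q) T"
    using assms(2,3) by (intro inj_onI) (simp add: subset_iff)
  then have surj: "(\<lambda>g. g \<otimes> q) ` T = T"
    using closed assms(1) by (intro endo_inj_surj) auto
  have inv_closed: "g \<otimes> inv q \<in> T" if "g \<in> T" for g
  proof -
    have "g \<in> (\<lambda>g. g \<otimes> q) ` T"
      using that surj by simp
    then obtain g' where "g' \<in> T" "g = g' \<otimes> q"
      by blast
    moreover from this have "g' \<in> carrier G"
      using assms(2) by blast
    ultimately show ?thesis
      using assms(3) by (simp add: m_assoc)
  qed
  \<comment> \<open>The element \<open>g\<close> stays quantified because the product case applies
    the hypothesis for \<open>h2\<close> at \<open>g \<otimes> h1\<close>.\<close>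
  have "\<forall>g\<in>T. g \<otimes> h \<in> T"
    using assms(5)
  proof (induction rule: generate.induct)
    case (eng h1 h2)
    have "h1 \<in> carrier G" "h2 \<in> carrier G"
      using eng.hyps generate_in_carrier[of "{q}"] assms(3) by auto
    then have "g \<otimes> (h1 \<otimes> h2) = (g \<otimes> h1) \<otimes> h2" if "g \<in> T" for g
      using that assms(2) by (metis m_assoc subsetD)
    then show ?case
      using eng.IH by simp
  next
    case one
    show ?case
    proof
      fix g assume "g \<in> T"
      moreover from this have "g \<in> carrier G"
        using assms(2) by blast
      ultimately show "g \<otimes> \<one> \<in> T"
        by simp
    qed
  qed (use closed inv_closed in auto)
  then show ?thesis
    using \<open>g \<in> T\<close> by blast
qed

section \<open>Indices in the template\<close>

locale ordered_group = group +
  fixes A :: "'a list"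
  assumes ordering: "ordering_of G A"
begin

abbreviation "P \<equiv> anti_phase_template G A"

lemma distinct_A: "distinct A" and set_A: "set A = carrier G"
  using ordering by (simp_all add: ordering_of_def)

lemma finite_G: "finite (carrier G)"
  using set_A finite_set[of A] by simp

lemma length_A: "length A = order G"
  using distinct_card[OF distinct_A] by (simp add: set_A order_def)

lemma nth_A [simp]: "i < length A \<Longrightarrow> A ! i \<in> carrier G"
  using set_A nth_mem by blast

lemma length_A_pos: "length A > 0"
  using set_A one_closed by (cases A) auto

lemma men_P [simp]: "men P = carrier G" and women_P [simp]: "women P = carrier G"
  by (simp_all add: anti_phase_template_def)

lemma man_pref_iff:
  assumes "g \<in> carrier G" "i < length A" "j < length A"
  shows "(g \<otimes> A ! i, g \<otimes> A ! j) \<in> man_pref P g \<longleftrightarrow> i < j"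
proof -
  have "distinct (map (\<lambda>a. g \<otimes> a) A)"
    using assms(1) distinct_A by (simp add: distinct_map set_A inj_on_cmult)
  from list_pref_nth_iff[OF this, of i j] show ?thesis
    using assms by (simp add: anti_phase_template_def)
qed

text \<open>The man \<open>h \<otimes> inv (A ! i)\<close> is the one who has \<open>h\<close> at
  position \<open>i\<close> of his list. The reversal of \<open>A\<close> makes \<open>h\<close>
  favour the men who like her least.\<close>

lemma woman_pref_iff:
  assumes "h \<in> carrier G" "i < length A" "j < length A"
  shows "(h \<otimes> inv (A ! i), h \<otimes> inv (A ! j)) \<in> woman_pref P h \<longleftrightarrow> j < i"
proof -
  have "inj_on (\<lambda>a. h \<otimes> inv a) (carrier G)"
    using assms(1) by (auto intro!: inj_onI) (metis inv_inv)
  then have "distinct (map (\<lambda>a. h \<otimes> inv a) A)"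
    using distinct_A by (simp add: distinct_map set_A)
  from list_pref_nth_iff[OF this, of j i] show ?thesis
    using assms by (simp add: anti_phase_template_def list_pref_rev flip: rev_map)
qed

lemma mult_nth_inject:
  assumes "g \<in> carrier G" "i < length A" "j < length A" "g \<otimes> A ! i = g \<otimes> A ! j"
  shows "i = j"
  using assms distinct_A by (simp add: nth_eq_iff_index_eq)

lemma mult_nth_cases:
  assumes "g \<in> carrier G" "h \<in> carrier G"
  obtains i where "i < length A" "h = g \<otimes> A ! i"
proof -
  have "inv g \<otimes> h \<in> set A"
    using assms by (simp add: set_A)
  then obtain i where "i < length A" "A ! i = inv g \<otimes> h"
    by (auto simp: in_set_conv_nth)
  then show ?thesis
    using that assms by (metis inv_solve_left' nth_A)
qed

lemma index_function_eqI:
  assumes "g \<in> carrier G" "t < length A" "\<mu> g = g \<otimes> A ! t"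
  shows "index_function G A \<mu> g = t"
  unfolding index_function_def
  using assms by (intro the_equality) (auto intro: mult_nth_inject)

text \<open>Left translation by \<open>g\<close> meets every woman exactly once along
  \<open>A\<close>, so the definite description denotes.\<close>

lemma index_function:
  assumes "matching P \<mu>" "g \<in> carrier G"
  shows "index_function G A \<mu> g < length A"
    and "\<mu> g = g \<otimes> A ! index_function G A \<mu> g"
proof -
  have "\<mu> g \<in> carrier G"
    using assms by (auto simp: matching_def dest: bij_betwE)
  then obtain t where "t < length A" "\<mu> g = g \<otimes> A ! t"
    using mult_nth_cases assms(2) by metis
  then show "index_function G A \<mu> g < length A"
    and "\<mu> g = g \<otimes> A ! index_function G A \<mu> g"
    using index_function_eqI[of g t \<mu>] assms(2) by auto
qed

lemma matching_eq_canonicalI: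
  assumes "matching P \<mu>" "\<And>g. g \<in> carrier G \<Longrightarrow> index_function G A \<mu> g = b"
  shows "\<mu> = canonical_matching G A b"
proof (rule extensionalityI[where A = "carrier G"])
  show "\<mu> \<in> extensional (carrier G)"
    using assms(1) by (simp add: matching_def)
  show "\<mu> g = canonical_matching G A b g" if "g \<in> carrier G" for g
    using index_function(2)[OF assms(1) that] assms(2) that by (simp add: canonical_matching_def)
qed (simp add: canonical_matching_def)

text \<open>The position \<open>i\<close> rates the pair for both sides: the man gains by lowering
  his index, the woman by raising that of her partner. With \<open>g'\<close> as her present
  partner, stability becomes a matter of comparing natural numbers.\<close>

lemma blocks_iff_index:
  assumes "matching P \<mu>" "g \<in> carrier G" "g' \<in> carrier G" "i < length A"
    and "\<mu> g' = g \<otimes> A ! i"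
  shows "blocks P \<mu> g (g \<otimes> A ! i) \<longleftrightarrow>
    i < index_function G A \<mu> g \<and> index_function G A \<mu> g' < i"
proof -
  let ?h = "g \<otimes> A ! i" and ?d = "index_function G A \<mu>"
  have d: "?d g < length A" "\<mu> g = g \<otimes> A ! ?d g" "?d g' < length A" "?h = g' \<otimes> A ! ?d g'"
    using index_function[OF assms(1)] assms by auto
  have h: "?h \<in> carrier G"
    using assms by simp
  have "inj_on \<mu> (carrier G)"
    using assms(1) by (simp add: matching_def bij_betw_def)
  then have "inv_into (carrier G) \<mu> ?h = g'"
    using assms by (metis inv_into_f_f)
  \<comment> \<open>Both rivals are expressed through \<open>?h\<close>, the form in which
    \<open>woman_pref_iff\<close> compares them.\<close>
  moreover have "g' = ?h \<otimes> inv (A ! ?d g')"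
    using d assms by (simp add: m_assoc)
  moreover have "g = ?h \<otimes> inv (A ! i)"
    using assms by (simp add: m_assoc)
  ultimately have "(g, inv_into (carrier G) \<mu> ?h) \<in> woman_pref P ?h \<longleftrightarrow> ?d g' < i"
    using woman_pref_iff[OF h assms(4) d(3)] by simp
  moreover have "(?h, \<mu> g) \<in> man_pref P g \<longleftrightarrow> i < ?d g"
    using man_pref_iff[OF assms(2,4) d(1)] d(2) by simp
  ultimately show ?thesis
    using assms(2) h by (simp add: blocks_def)
qed

lemma max_index_step:
  assumes "\<mu> \<in> Stab P" "g \<in> carrier G" "index_function G A \<mu> g = b" "b \<ge> 1"
    and le: "\<And>g. g \<in> carrier G \<Longrightarrow> index_function G A \<mu> g \<le> b"
  shows "index_function G A \<mu> (g \<otimes> step_quotient G A b) = b"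
proof -
  let ?h = "g \<otimes> A ! (b - 1)"
  have \<mu>: "matching P \<mu>" and stable: "\<And>m w. \<not> blocks P \<mu> m w"
    using assms(1) by (auto simp: Stab_def)
  have b: "b < length A"
    using index_function(1)[OF \<mu> assms(2)] assms(3) by simp
  then have "?h \<in> \<mu> ` carrier G"
    using \<mu> assms(2) by (simp add: matching_def bij_betw_def)
  then obtain g' where g': "g' \<in> carrier G" "\<mu> g' = ?h"
    by auto
  have g'_eq: "g' = ?h \<otimes> inv (A ! index_function G A \<mu> g')"
    using index_function[OF \<mu> g'(1)] g' by (metis inv_solve_right nth_A m_closed)
  \<comment> \<open>Otherwise \<open>g\<close> and \<open>?h\<close> would block: \<open>g\<close>
    would descend from \<open>b\<close> to \<open>b - 1\<close>, and \<open>?h\<close> would ascend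
    to \<open>b - 1\<close>.\<close>
  have "\<not> index_function G A \<mu> g' < b - 1"
    using blocks_iff_index[OF \<mu> assms(2) g'(1) _ g'(2)] stable b assms(3,4) by auto
  \<comment> \<open>Index \<open>b - 1\<close> would identify \<open>g'\<close> with
    \<open>g\<close>, whose index is \<open>b\<close>, and these differ since
    \<open>b \<ge> 1\<close>.\<close>
  moreover have "index_function G A \<mu> g' \<noteq> b - 1"
  proof
    assume "index_function G A \<mu> g' = b - 1"
    then have "g' = g"
      using g'_eq assms(2) b by (simp add: m_assoc)
    then show False
      using \<open>index_function G A \<mu> g' = b - 1\<close> assms(3,4) by simp
  qed
  ultimately have "index_function G A \<mu> g' = b"
    using le[OF g'(1)] by linarith
  moreover from this have "g' = g \<otimes> step_quotient G A b"
    using g'_eq assms(2) b by (simp add: step_quotient_def m_assoc)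
  ultimately show ?thesis
    by simp
qed

lemma stable_eq_canonical:
  assumes "\<mu> \<in> Stab P" "b = Max (index_function G A \<mu> ` carrier G)"
    and b: "b = 0 \<or> b \<ge> 1 \<and> generate G {step_quotient G A b} = carrier G"
  shows "\<mu> = canonical_matching G A b"
proof -
  let ?d = "index_function G A \<mu>" and ?q = "step_quotient G A b"
  have \<mu>: "matching P \<mu>"
    using assms(1) by (simp add: Stab_def)
  have le: "?d g \<le> b" if "g \<in> carrier G" for g
    using that assms(2) finite_G by simp
  have "?d g = b" if g: "g \<in> carrier G" for g
  proof (cases "b = 0")
    case True
    then show ?thesis
      using le[OF g] by simp
  next
    case False
    then have b1: "b \<ge> 1" and gen: "generate G {?q} = carrier G"
      using b by auto
    have "b \<in> ?d ` carrier G"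
      using assms(2) finite_G Max_in[of "?d ` carrier G"] one_closed by blast
    then obtain g0 where g0: "g0 \<in> carrier G" "?d g0 = b"
      by auto
    have "b < length A"
      using index_function(1)[OF \<mu> g0(1)] g0(2) by simp
    then have q: "?q \<in> carrier G"
      by (simp add: step_quotient_def)
    define T where "T = {g \<in> carrier G. ?d g = b}"
    \<comment> \<open>An arbitrary man \<open>g\<close> is reached from the maximizer
      \<open>g0\<close> by a translation that lies in the generated subgroup.\<close>
    have "g0 \<otimes> (inv g0 \<otimes> g) \<in> T"
    proof (rule generate_singleton_right_closed)
      show "finite T" "T \<subseteq> carrier G" "g0 \<in> T"
        using finite_G g0 by (auto simp: T_def)
      show "g \<otimes> ?q \<in> T" if "g \<in> T" for g
        using that max_index_step[OF assms(1) _ _ b1 le] q by (auto simp: T_def)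
      show "inv g0 \<otimes> g \<in> generate G {?q}"
        using gen g g0 by simp
    qed (fact q)
    then show ?thesis
      using g g0 by (simp add: T_def flip: m_assoc)
  qed
  then show ?thesis
    by (rule matching_eq_canonicalI[OF \<mu>])
qed

section \<open>Canonical matchings and the chain\<close>

lemma canonical_matching_stable:
  assumes t: "t < length A"
  shows "canonical_matching G A t \<in> Stab P"
proof -
  let ?\<mu> = "canonical_matching G A t"
  have "bij_betw (\<lambda>g. g \<otimes> A ! t) (carrier G) (carrier G)"
    using t by (intro bij_betwI[where g = "\<lambda>h. h \<otimes> inv (A ! t)"]) (auto simp: m_assoc)
  also have "?this \<longleftrightarrow> bij_betw ?\<mu> (carrier G) (carrier G)"
    by (rule bij_betw_cong) (simp add: canonical_matching_def)
  finally have \<mu>: "matching P ?\<mu>"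
    by (simp add: matching_def canonical_matching_def)
  have d: "index_function G A ?\<mu> g = t" if "g \<in> carrier G" for g
    using that t by (intro index_function_eqI) (simp_all add: canonical_matching_def)
  have "\<not> blocks P ?\<mu> g h" for g h
  proof
    assume bl: "blocks P ?\<mu> g h"
    then have gh: "g \<in> carrier G" "h \<in> carrier G"
      by (simp_all add: blocks_def)
    obtain i where i: "i < length A" "h = g \<otimes> A ! i"
      using mult_nth_cases[OF gh] .
    have "h \<in> ?\<mu> ` carrier G"
      using \<mu> gh(2) by (simp add: matching_def bij_betw_def)
    then obtain g' where "g' \<in> carrier G" "?\<mu> g' = h"
      by auto
    \<comment> \<open>All indices equal \<open>t\<close>, so a blocking pair at position
      \<open>i\<close> would need both \<open>i < t\<close> and \<open>t < i\<close>.\<close>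
    then show False
      using blocks_iff_index[OF \<mu> gh(1) _ i(1), of g'] bl d gh(1) i(2) by auto
  qed
  then show ?thesis
    using \<mu> by (simp add: Stab_def)
qed

lemma inj_on_canonical_matching: "inj_on (canonical_matching G A) {..<length A}"
proof (rule inj_onI)
  fix s t assume st: "s \<in> {..<length A}" "t \<in> {..<length A}"
    and "canonical_matching G A s = canonical_matching G A t"
  then have "\<one> \<otimes> A ! s = \<one> \<otimes> A ! t"
    unfolding canonical_matching_def by (metis one_closed restrict_apply')
  then show "s = t"
    using mult_nth_inject st by blast
qed

text \<open>Every man makes the same comparison of positions, so the men are unanimous.\<close>

lemma men_dominates_canonical_iff:
  assumes "s < length A" "t < length A"
  shows "men_dominates P (canonical_matching G A s) (canonical_matching G A t) \<longleftrightarrow> s \<le> t"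
proof -
  have "g \<otimes> A ! s = g \<otimes> A ! t \<or> (g \<otimes> A ! s, g \<otimes> A ! t) \<in> man_pref P g \<longleftrightarrow> s \<le> t"
    if "g \<in> carrier G" for g
    using that assms mult_nth_inject[OF that assms] man_pref_iff[OF that assms]
    by (auto simp: le_less)
  \<comment> \<open>The man \<open>\<one>\<close> witnesses that there is a man at all, without
    which dominance would hold vacuously.\<close>
  then show ?thesis
    using one_closed by (auto simp: men_dominates_def canonical_matching_def)
qed

text \<open>A stable matching is the canonical one at its own maximal index; \<open>b = 0\<close>
  falls under the first alternative of \<open>stable_eq_canonical\<close>.\<close>

lemma Stab_eq_canonical:
  assumes "\<And>b. \<lbrakk>1 \<le> b; b < length A\<rbrakk> \<Longrightarrow> generate G {step_quotient G A b} = carrier G"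
  shows "Stab P = canonical_matching G A ` {..<length A}"
proof
  show "canonical_matching G A ` {..<length A} \<subseteq> Stab P"
    using canonical_matching_stable by auto
  show "Stab P \<subseteq> canonical_matching G A ` {..<length A}"
  proof
    fix \<mu> assume \<mu>: "\<mu> \<in> Stab P"
    define b where "b = Max (index_function G A \<mu> ` carrier G)"
    have "b \<in> index_function G A \<mu> ` carrier G"
      unfolding b_def using finite_G one_closed by (intro Max_in) auto
    then have "b < length A"
      using \<mu> index_function(1) by (auto simp: Stab_def)
    moreover from this have "\<mu> = canonical_matching G A b"
      using assms[of b] by (intro stable_eq_canonical[OF \<mu> b_def]) linarith
    ultimately show "\<mu> \<in> canonical_matching G A ` {..<length A}"
      by blast
  qed
qed

text \<open>Writing each stable matching as a canonical one turns the order axioms and totality into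
  those of the natural numbers, with the order of indices reversed.\<close>

lemma total_order_stable_lattice:
  assumes "Stab P = canonical_matching G A ` {..<length A}"
  shows "total_order (stable_lattice P)"
proof -
  have carrier: "\<exists>t<length A. \<mu> = canonical_matching G A t" if "\<mu> \<in> Stab P" for \<mu>
    using that assms by auto
  show ?thesis
    by unfold_locales
      (auto simp: stable_lattice_def men_dominates_canonical_iff dest!: carrier)
qed

end

theorem theorem5p6:
  fixes G :: "('a, 'b) monoid_scheme" and A :: "'a list" and n :: nat
  assumes "group G" and "finite (carrier G)" and "order G = n"
    and "ordering_of G A"
  shows "(\<forall>\<mu> b. \<mu> \<in> Stab (anti_phase_template G A) \<longrightarrow>
           b = Max (index_function G A \<mu> ` carrier G) \<longrightarrow>
           b = 0 \<or> (b \<ge> 1 \<and> generate G {step_quotient G A b} = carrier G) \<longrightarrow>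
           \<mu> = canonical_matching G A b) \<and>
         ((\<forall>b\<in>{1..n - 1}. generate G {step_quotient G A b} = carrier G) \<longrightarrow>
           Stab (anti_phase_template G A) = canonical_matching G A ` {0..n - 1} \<and>
           card (Stab (anti_phase_template G A)) = n \<and>
           total_order (stable_lattice (anti_phase_template G A)) \<and>
           card (carrier (stable_lattice (anti_phase_template G A))) = n)"
proof -
  interpret ordered_group G A
    using assms by (simp add: ordered_group_def ordered_group_axioms_def)
  have len: "length A = n"
    using assms(3) length_A by simp
  \<comment> \<open>A group is nonempty, so \<open>n > 0\<close> and the subtraction is not
    truncated.\<close>
  have range: "{..<length A} = {0..n - 1}"
    using length_A_pos len by (cases n) auto
  have chain: "Stab P = canonical_matching G A ` {0..n - 1} \<and> card (Stab P) = n \<and>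
      total_order (stable_lattice P) \<and> card (carrier (stable_lattice P)) = n"
    if "\<forall>b\<in>{1..n - 1}. generate G {step_quotient G A b} = carrier G"
  proof -
    have Stab: "Stab P = canonical_matching G A ` {..<length A}"
      using that len by (intro Stab_eq_canonical) auto
    then have "card (Stab P) = n"
      using card_image[OF inj_on_canonical_matching] len by simp
    then show ?thesis
      using Stab total_order_stable_lattice[OF Stab] range by (simp add: stable_lattice_def)
  qed
  show ?thesis
    using stable_eq_canonical chain by blast
qed

end
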